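(* Let $2 \le r \le l$ be integers and let $e = rl + r - 1$. Let $p, q$ be integers such that one of the following conditions holds: 1. $r = 2$, $2 \le p \le q$, and $l = \frac{e-1}{2} < q$; 2. $3 \le r \le l$ and $r \le p \le l+1 \le q \le l + 1 + \frac{l}{r-1}$. Let $G_{r,l+1}$ be the graph obtained from the complete bipartite graph $K_{r-1,l+1}$ by adding one vertex to the group of $r-1$ vertices and connecting it to exactly $l$ vertices in the group of $l+1$ vertices. Then $\lambda_{\max}(G) \le \lambda_{\max}(G_{r,l+1})$ for all $G \in \mathcal{K}(p,q,e)$. Equality holds if and only if $G$ is isomorphic to $G_{r,l+1}$.
   Context: All graphs are finite, simple and undirected. $\lambda_{\max}(G)$ denotes the largest eigenvalue of the adjacency matrix of $G$. $K_{p,q}$ is the complete bipartite graph with sides of sizes $p$ and $q$. For positive integers $p \le q$ and $e \le pq$, $\mathcal{K}(p,q,e)$ denotes the family of subgraphs of $K_{p,q}$ (a subgraph may use only some of the vertices of $K_{p,q}$) that have exactly $e$ edges, have no isolated vertices, and are not complete bipartite graphs. *)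

theory Defs
  imports
    "Graph_Theory.Graph_Theory"
    "Jordan_Normal_Form.Spectral_Radius"
begin

text \<open>
  Finite simple undirected graphs are the library's \<open>pair_graph\<close>s: finite, loop-free, symmetric
  digraphs without parallel arcs. An undirected edge \<open>{u, v}\<close> corresponds to the two
  arcs \<open>(u, v)\<close> and \<open>(v, u)\<close>.
\<close>

definition edge_set :: "'a pair_pre_digraph \<Rightarrow> 'a set set" where
  "edge_set G = {{u, v} | u v. (u, v) \<in> parcs G}"

text \<open>
  Matrices of type \<open>mat\<close> are indexed by natural numbers, so the vertices are listed in some order.
  A different order conjugates the matrix by a permutation matrix and leaves the eigenvalues
  unchanged.
\<close>

definition vertex_list :: "'a pair_pre_digraph \<Rightarrow> 'a list" where
  "vertex_list G = (SOME vs. distinct vs \<and> set vs = pverts G)"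

definition adjacency_matrix :: "'a pair_pre_digraph \<Rightarrow> real mat" where
  "adjacency_matrix G =
     mat (card (pverts G)) (card (pverts G))
       (\<lambda>(i, j). if (vertex_list G ! i, vertex_list G ! j) \<in> parcs G then 1 else 0)"

text \<open>
  The adjacency matrix of a graph is real symmetric, so its real spectrum contains all of its
  eigenvalues, and it is finite and (if the graph has a vertex) nonempty.
\<close>

definition lambda_max :: "'a pair_pre_digraph \<Rightarrow> real" where
  "lambda_max G = Max (spectrum (adjacency_matrix G))"

text \<open>
  The family \<open>\<K>(p, q, e)\<close>, with vertices drawn from the type \<open>'a\<close>. The predicate
  \<^const>\<open>complete_bipartite_digraph\<close> holds of every graph on \<open>'a\<close> isomorphic to \<open>K\<^sub>p\<^sub>,\<^sub>q\<close>, so the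
  ambient graph \<open>H\<close> is an arbitrary copy of \<open>K\<^sub>p\<^sub>,\<^sub>q\<close>.
\<close>

definition bipartite_family :: "nat \<Rightarrow> nat \<Rightarrow> nat \<Rightarrow> 'a pair_pre_digraph set" where
  "bipartite_family p q e =
     {G. pair_graph G \<and>
         (\<exists>H :: 'a pair_pre_digraph.
            complete_bipartite_digraph p q (with_proj H) \<and> subgraph (with_proj G) (with_proj H)) \<and>
         card (edge_set G) = e \<and>
         (\<forall>u \<in> pverts G. \<exists>v. (u, v) \<in> parcs G) \<and>
         \<not> (\<exists>m n. complete_bipartite_digraph m n (with_proj G))}"

definition complete_bipartite_graph :: "nat \<Rightarrow> nat \<Rightarrow> (nat + nat) pair_pre_digraph" where
  "complete_bipartite_graph m n =
     (let A = Inl ` {..<m}; B = Inr ` {..<n}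
      in \<lparr> pverts = A \<union> B, parcs = A \<times> B \<union> B \<times> A \<rparr>)"

text \<open>
  The graph \<open>G\<^bsub>r,l+1\<^esub>\<close>. Note that the second parameter here is \<open>l\<close>, not \<open>l + 1\<close>. The added vertex
  is \<open>Inl (r - 1)\<close>, and \<open>N\<close> is its set of neighbours.
\<close>

definition extremal_graph :: "nat \<Rightarrow> nat \<Rightarrow> (nat + nat) pair_pre_digraph" where
  "extremal_graph r l =
     (let K = complete_bipartite_graph (r - 1) (l + 1); w = Inl (r - 1); N = Inr ` {..<l}
      in \<lparr> pverts = insert w (pverts K), parcs = parcs K \<union> {w} \<times> N \<union> N \<times> {w} \<rparr>)"

end

theory Submission
  imports Defs "HOL-Analysis.Convex"
begin

text \<open>
  View \<open>G\<close> as a 0-1 matrix with \<open>e\<close> ones and singular values \<open>\<sigma>\<^sub>1 \<ge> \<sigma>\<^sub>2 \<ge> \<dots>\<close>. Then \<open>\<sigma>\<^sub>1\<^sup>4 \<le> \<Sum> \<sigma>\<^sub>i\<^sup>4 = e\<^sup>2 - 2 T\<close>,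
  where \<open>T\<close> is the number of unordered pairs of edges \<open>i j\<close>, \<open>i' j'\<close> such that \<open>i j'\<close> or \<open>i' j\<close> is not an
  edge. Write \<open>n = r - 1\<close>. The extremal graph has rank 2 and \<open>T = n l\<close>, so that
  \<open>\<sigma>\<^sub>1\<^sup>4 = e\<^sup>2 - 2 n l - \<sigma>\<^sub>2\<^sup>4 > e\<^sup>2 - 2 n l - 1\<close>. As \<open>T\<close> is an integer, it is enough that every other graph
  of the family has \<open>T > n l\<close>. The hypotheses on \<open>p\<close> and \<open>q\<close> serve only to force more than \<open>n\<close> vertices on
  each side. Now let \<open>u v\<close> be a nonedge with the least degree sum, and let \<open>d\<close> and \<open>c\<close> be the degrees of \<open>u\<close>
  and \<open>v\<close>. Counting the pairs with an edge at \<open>u\<close> or \<open>v\<close> in three ways gives bounds on \<open>T\<close> which together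
  leave only \<open>{c, d} = {n, l}\<close> and the complete bipartite graph without \<open>u v\<close>.
\<close>

section \<open>Pairs of edges whose two cross pairs are edges, and pairs that fail this\<close>

definition rectangles :: "('a \<times> 'b) set \<Rightarrow> (('a \<times> 'b) \<times> ('a \<times> 'b)) set" where
  "rectangles E = {(f, g) \<in> E \<times> E. (fst f, snd g) \<in> E \<and> (fst g, snd f) \<in> E}"

text \<open>Ordered pairs again, and never an edge with itself, so the cardinality is
  \<open>2 T\<close>.\<close>

definition defects :: "('a \<times> 'b) set \<Rightarrow> (('a \<times> 'b) \<times> ('a \<times> 'b)) set" where
  "defects E = E \<times> E - rectangles E"

lemma finite_rectangles: "finite E \<Longrightarrow> finite (rectangles E)"
  by (rule finite_subset[of _ "E \<times> E"]) (auto simp: rectangles_def)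

lemma finite_defects: "finite E \<Longrightarrow> finite (defects E)"
  by (simp add: defects_def)

lemma card_rectangles_defects:
  assumes "finite E"
  shows "card (rectangles E) + card (defects E) = (card E)\<^sup>2"
proof -
  have "rectangles E \<subseteq> E \<times> E" by (auto simp: rectangles_def)
  then have "card (E \<times> E) = card (rectangles E) + card (defects E)"
    unfolding defects_def using assms
    by (metis card_Diff_subset card_mono finite_SigmaI finite_rectangles le_add_diff_inverse)
  then show ?thesis by (simp add: card_cartesian_product power2_eq_square)
qed

text \<open>Exchanging the two edges of a defect gives a defect, so \<open>S\<close> and its mirror
  image are disjoint parts of \<open>defects E\<close>. Each lower bound on \<open>T\<close> below
  comes from one choice of \<open>S\<close>.\<close>

lemma card_defects_ge:
  assumes "finite E" "S \<subseteq> defects E" "\<And>f g. (f, g) \<in> S \<Longrightarrow> (g, f) \<notin> S"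
  shows "2 * card S \<le> card (defects E)"
proof -
  have fin: "finite S" using assms(1,2) finite_defects finite_subset by blast
  have "S \<union> prod.swap ` S \<subseteq> defects E"
    using assms(2) by (auto simp: defects_def rectangles_def)
  then have "card (S \<union> prod.swap ` S) \<le> card (defects E)"
    by (intro card_mono finite_defects assms)
  moreover have "card (S \<union> prod.swap ` S) = card S + card (prod.swap ` S)"
    using fin assms(3) by (intro card_Un_disjoint) auto
  moreover have "card (prod.swap ` S) = card S"
    by (rule card_image) simp
  ultimately show ?thesis by simp
qed

text \<open>Lets the estimate at a right vertex serve for left vertices too.\<close>

lemma card_defects_converse: "card (defects (E\<inverse>)) = card (defects E)"
proof -
  have "map_prod prod.swap prod.swap ` defects E = defects (E\<inverse>)"
    by (force simp: defects_def rectangles_def image_iff)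
  moreover have "inj_on (map_prod prod.swap prod.swap) (defects E)"
    by (intro inj_onI) auto
  ultimately show ?thesis by (metis card_image)
qed

lemma card_at_left: "card {f \<in> E. fst f = u} = card (E `` {u})"
proof -
  have "{f \<in> E. fst f = u} = Pair u ` (E `` {u})" by force
  then show ?thesis by (simp add: card_image inj_on_def)
qed

lemma card_at_right: "card {f \<in> E. snd f = v} = card (E\<inverse> `` {v})"
proof -
  have "{f \<in> E. snd f = v} = (\<lambda>i. (i, v)) ` (E\<inverse> `` {v})" by force
  then show ?thesis by (simp add: card_image inj_on_def)
qed

section \<open>Counting edges and defects around a nonedge\<close>

text \<open>For a nonedge \<open>(u, v)\<close> such edges avoid \<open>u\<close> and
  \<open>v\<close> by themselves, whereas \<open>outer_edges\<close> has to demand it.\<close>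

definition inner_edges :: "('a \<times> 'b) set \<Rightarrow> 'a \<Rightarrow> 'b \<Rightarrow> ('a \<times> 'b) set" where
  "inner_edges E u v = {(i, j) \<in> E. (u, j) \<in> E \<and> (i, v) \<in> E}"

definition outer_edges :: "('a \<times> 'b) set \<Rightarrow> 'a \<Rightarrow> 'b \<Rightarrow> ('a \<times> 'b) set" where
  "outer_edges E u v = {(i, j) \<in> E. i \<noteq> u \<and> j \<noteq> v \<and> ((u, j) \<notin> E \<or> (i, v) \<notin> E)}"

lemma card_edges_around_nonedge:
  assumes fin: "finite E" and uv: "(u, v) \<notin> E"
  shows "card E = card (E `` {u}) + card (E\<inverse> `` {v}) + card (inner_edges E u v) + card (outer_edges E u v)"
proof -
  let ?A = "{f \<in> E. fst f = u}" and ?B = "{f \<in> E. snd f = v}"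
  have "E = (?A \<union> ?B) \<union> (inner_edges E u v \<union> outer_edges E u v)"
    by (auto simp: inner_edges_def outer_edges_def)
  moreover have "card ((?A \<union> ?B) \<union> (inner_edges E u v \<union> outer_edges E u v))
      = card (?A \<union> ?B) + card (inner_edges E u v \<union> outer_edges E u v)"
    using fin uv by (intro card_Un_disjoint)
      (auto simp: inner_edges_def outer_edges_def intro: finite_subset[OF _ fin])
  moreover have "card (?A \<union> ?B) = card ?A + card ?B"
    using fin uv by (intro card_Un_disjoint) auto
  moreover have "card (inner_edges E u v \<union> outer_edges E u v)
      = card (inner_edges E u v) + card (outer_edges E u v)"
    using fin by (intro card_Un_disjoint)
      (auto simp: inner_edges_def outer_edges_def intro: finite_subset[OF _ fin])
  ultimately show ?thesis by (simp add: card_at_left card_at_right)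
qed

text \<open>An edge at \<open>u\<close> and an edge at \<open>v\<close> always form a defect,
  because the cross pair \<open>(u, v)\<close> is missing. Every outer edge adds one further defect
  with an edge at \<open>u\<close> or at \<open>v\<close>.\<close>

lemma card_defects_at_nonedge:
  assumes fin: "finite E" and uv: "(u, v) \<notin> E" and "u \<in> Domain E" "v \<in> Range E"
  shows "2 * (card (E `` {u}) * card (E\<inverse> `` {v}) + card (outer_edges E u v)) \<le> card (defects E)"
proof -
  obtain j0 where j0: "(u, j0) \<in> E" using assms(3) by blast
  obtain i0 where i0: "(i0, v) \<in> E" using assms(4) by blast
  \<comment> \<open>The partner of an outer edge \<open>(i, j)\<close> is chosen by which cross pair
    is missing: \<open>(u, j)\<close> for the edge \<open>(u, j0)\<close>, otherwise
    \<open>(i, v)\<close> for the edge \<open>(i0, v)\<close>.\<close>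
  define g where "g f = (if (u, snd f) \<notin> E then (u, j0) else (i0, v))" for f :: "'a \<times> 'b"
  let ?A = "{f \<in> E. fst f = u}" and ?B = "{f \<in> E. snd f = v}"
  define S where "S = ?A \<times> ?B \<union> (\<lambda>f. (f, g f)) ` outer_edges E u v"
  have nuv: "snd f \<noteq> v" if "f \<in> E" "fst f = u" for f
    using uv that by (metis prod.collapse)
  have "2 * card S \<le> card (defects E)"
  proof (rule card_defects_ge[OF fin])
    show "S \<subseteq> defects E"
      using uv i0 j0 by (auto simp: S_def defects_def rectangles_def outer_edges_def g_def split: if_splits)
    show "(f, f') \<in> S \<Longrightarrow> (f', f) \<notin> S" for f f'
      using uv i0 j0 nuv by (auto simp: S_def outer_edges_def g_def split: if_splits)
  qed
  moreover have "card S = card (?A \<times> ?B) + card ((\<lambda>f. (f, g f)) ` outer_edges E u v)"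
    unfolding S_def using fin
    by (intro card_Un_disjoint)
      (auto simp: outer_edges_def intro!: finite_imageI intro: finite_subset[OF _ fin])
  moreover have "card ((\<lambda>f. (f, g f)) ` outer_edges E u v) = card (outer_edges E u v)"
    by (intro card_image inj_onI) auto
  ultimately show ?thesis by (simp add: card_cartesian_product card_at_left card_at_right)
qed

text \<open>An edge whose left end misses \<open>v\<close> forms a defect with every edge at
  \<open>v\<close>. Each left vertex that misses \<open>v\<close> supplies at least \<open>d\<close>
  edges of the first kind.\<close>

lemma card_defects_at_column:
  assumes fin: "finite E"
    and deg: "\<And>i. i \<in> Domain E \<Longrightarrow> (i, v) \<notin> E \<Longrightarrow> d \<le> card (E `` {i})"
  shows "2 * (card (E\<inverse> `` {v}) * ((card (Domain E) - card (E\<inverse> `` {v})) * d)) \<le> card (defects E)"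
proof -
  let ?F = "{f \<in> E. (fst f, v) \<notin> E}" and ?B = "{f \<in> E. snd f = v}"
  let ?I = "Domain E - E\<inverse> `` {v}"
  have finD: "finite (Domain E)" using fin by (simp add: finite_Domain)
  have "2 * card (?F \<times> ?B) \<le> card (defects E)"
    by (rule card_defects_ge[OF fin]) (auto simp: defects_def rectangles_def)
  moreover have "card ?I * d \<le> card ?F"
  proof -
    have "?F = Sigma ?I (\<lambda>i. E `` {i})" by auto
    then have "card ?F = (\<Sum>i\<in>?I. card (E `` {i}))"
      using finD fin by (simp add: card_SigmaI finite_Image)
    also have "\<dots> \<ge> card ?I * d"
      using sum_bounded_below[of ?I d "\<lambda>i. card (E `` {i})"] deg by auto
    finally show ?thesis .
  qed
  moreover have "card ?I = card (Domain E) - card (E\<inverse> `` {v})"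
    by (rule card_Diff_subset) (use fin in \<open>auto simp: finite_Image\<close>)
  ultimately have I: "(card (Domain E) - card (E\<inverse> `` {v})) * d \<le> card ?F"
    and S: "2 * card (?F \<times> ?B) \<le> card (defects E)" by simp_all
  have "card (?F \<times> ?B) = card (E\<inverse> `` {v}) * card ?F"
    by (simp only: card_cartesian_product card_at_right mult.commute)
  then show ?thesis using S mult_le_mono2[OF I, of "card (E\<inverse> `` {v})"] by linarith
qed

section \<open>The structure of relations with few defects\<close>

text \<open>The arithmetic of the three bounds: \<open>c\<close> and \<open>d\<close> are the
  degrees of \<open>v\<close> and \<open>u\<close>, \<open>x\<close> and \<open>y\<close> count the
  inner and outer edges, \<open>a\<close> and \<open>b\<close> are the sizes of the sides. Bound
  \<open>m\<close> excludes that both degrees exceed \<open>n\<close>; bounds \<open>a\<close> and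
  \<open>b\<close> treat a degree of at most \<open>n\<close>.\<close>

lemma factors_of_few_defects:
  fixes n l c d x y a b :: nat
  assumes n: "1 \<le> n" "n \<le> l" and cd: "1 \<le> c" "1 \<le> d"
    and e: "n * l + l + n = d + c + x + y" and x: "x \<le> c * d"
    and m: "d * c + y \<le> n * l" and a: "c * ((a - c) * d) \<le> n * l" "n < a"
    and b: "d * ((b - d) * c) \<le> n * l" "n < b"
  shows "(c = n \<and> d = l \<or> c = l \<and> d = n) \<and> y = 0 \<and> x = c * d"
proof -
  \<comment> \<open>\<open>x + y\<close> is at most \<open>c * d + y\<close>, hence at most
    \<open>n * l\<close>.\<close>
  have s: "n + l \<le> c + d" using e x m by (simp add: mult.commute)
  \<comment> \<open>Stated for fresh variables because it is applied once to each side. The point is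
    \<open>c' * (a' - c') \<ge> n\<close>: at least \<open>k + 1\<close> vertices lie outside the
    neighbourhood, and \<open>c' * (k + 1) \<ge> c' + k = n\<close>. This forces
    \<open>d' \<le> l\<close>, and the degree sum does the rest.\<close>
  have small: "d' = l \<and> c' = n"
    if "c' \<le> n" "1 \<le> c'" "n < a'" "c' * ((a' - c') * d') \<le> n * l" "n + l \<le> c' + d'" for a' c' d'
  proof -
    define k where "k = n - c'"
    have k: "n = c' + k" using that(1) by (simp add: k_def)
    have "k \<le> c' * k" using that(2) by (cases c') auto
    then have "n \<le> c' * (k + 1)" unfolding k by simp
    also have "\<dots> \<le> c' * (a' - c')" using that(3) k by (intro mult_le_mono2) auto
    finally have "n * d' \<le> c' * (a' - c') * d'" by (rule mult_le_mono1)
    then have "n * d' \<le> n * l" using that(4) unfolding mult.assoc by (rule le_trans)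
    then have "d' \<le> l" using n(1) by simp
    then show ?thesis using that(1,5) by linarith
  qed
  \<comment> \<open>If both exceeded \<open>n\<close>, then \<open>s\<close> bounds \<open>l\<close>
    so that \<open>n * l < d * c\<close>, against \<open>m\<close>.\<close>
  have "c \<le> n \<or> d \<le> n"
  proof (rule ccontr)
    assume "\<not> (c \<le> n \<or> d \<le> n)"
    moreover define i j where "i = c - (n + 1)" and "j = d - (n + 1)"
    ultimately have ij: "c = n + 1 + i" "d = n + 1 + j" by simp_all
    have "l \<le> n + 2 + i + j" using s ij by simp
    then have "n * l \<le> n * (n + 2 + i + j)" by (rule mult_le_mono2)
    also have "\<dots> < d * c" unfolding ij by (simp add: algebra_simps)
    finally show False using m by simp
  qed
  then have cd': "c = n \<and> d = l \<or> c = l \<and> d = n"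
  proof
    assume "c \<le> n"
    then show ?thesis using small[OF _ cd(1) a(2,1) s] by simp
  next
    assume "d \<le> n"
    then show ?thesis using small[OF _ cd(2) b(2,1)] s by simp
  qed
  then show ?thesis using e x m by (auto simp: mult.commute)
qed

theorem few_defects:
  fixes E :: "('a \<times> 'b) set"
  assumes fin: "finite E" and n: "1 \<le> n" "n \<le> l" and e: "card E = n * l + l + n"
    and sides: "n < card (Domain E)" "n < card (Range E)"
    and nc: "E \<noteq> Domain E \<times> Range E"
    and few: "card (defects E) \<le> 2 * (n * l)"
  obtains u v where "u \<in> Domain E" "v \<in> Range E" "E = Domain E \<times> Range E - {(u, v)}"
    "card (Domain E) = n + 1 \<and> card (Range E) = l + 1 \<or> card (Domain E) = l + 1 \<and> card (Range E) = n + 1"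
proof -
  let ?N = "\<lambda>(u, v). u \<in> Domain E \<and> v \<in> Range E \<and> (u, v) \<notin> E"
  let ?w = "\<lambda>(u, v). card (E `` {u}) + card (E\<inverse> `` {v})"
  obtain z0 where "?N z0" using nc by auto
  \<comment> \<open>Minimality supplies the degree condition of the column estimate: for a nonedge
    \<open>(i, v)\<close> the common summand of \<open>v\<close> cancels, so \<open>i\<close> has
    degree at least that of \<open>u\<close>. The same holds along \<open>u\<close>.\<close>
  from ex_has_least_nat[of ?N, OF this] obtain z where z: "?N z" "\<forall>z'. ?N z' \<longrightarrow> ?w z \<le> ?w z'"
    by blast
  obtain u v where "z = (u, v)" by (cases z)
  with z have uv: "u \<in> Domain E" "v \<in> Range E" "(u, v) \<notin> E"
    and least: "\<And>i j. i \<in> Domain E \<Longrightarrow> j \<in> Range E \<Longrightarrow> (i, j) \<notin> E \<Longrightarrow>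
      card (E `` {u}) + card (E\<inverse> `` {v}) \<le> card (E `` {i}) + card (E\<inverse> `` {j})"
    by auto
  define c d where "c = card (E\<inverse> `` {v})" and "d = card (E `` {u})"
  have fin': "finite (E\<inverse>)" using fin by simp
  have inner: "inner_edges E u v \<subseteq> E\<inverse> `` {v} \<times> E `` {u}" by (auto simp: inner_edges_def)
  have x: "card (inner_edges E u v) \<le> c * d"
    unfolding c_def d_def card_cartesian_product[symmetric]
    using inner by (intro card_mono) (use fin in \<open>auto simp: finite_Image\<close>)
  have pos: "1 \<le> c" "1 \<le> d"
    using uv fin by (auto simp: c_def d_def Suc_le_eq card_gt_0_iff finite_Image)
  have "2 * (c * ((card (Domain E) - c) * d)) \<le> card (defects E)"
    unfolding c_def using least[OF _ uv(2)] by (intro card_defects_at_column fin) (simp add: d_def)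
  then have a: "c * ((card (Domain E) - c) * d) \<le> n * l" using few by simp
  have "2 * (d * ((card (Range E) - d) * c)) \<le> card (defects (E\<inverse>))"
    using card_defects_at_column[OF fin', of u c] least[OF uv(1)] by (simp add: d_def c_def)
  then have b: "d * ((card (Range E) - d) * c) \<le> n * l" using few by (simp add: card_defects_converse)
  have m: "d * c + card (outer_edges E u v) \<le> n * l"
    using card_defects_at_nonedge[OF fin uv(3,1,2)] few by (simp add: c_def d_def)
  have *: "(c = n \<and> d = l \<or> c = l \<and> d = n) \<and> card (outer_edges E u v) = 0
      \<and> card (inner_edges E u v) = c * d"
    using factors_of_few_defects[OF n pos _ x m a sides(1) b sides(2)]
      card_edges_around_nonedge[OF fin uv(3)] e by (simp add: c_def d_def)
  have outer: "outer_edges E u v = {}"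
  proof -
    have "outer_edges E u v \<subseteq> E" by (auto simp: outer_edges_def)
    then have "finite (outer_edges E u v)" by (rule finite_subset[OF _ fin])
    then show ?thesis using * by simp
  qed
  \<comment> \<open>Equal cardinalities turn the inclusion \<open>inner\<close> into an equality, so
    the neighbourhoods of \<open>v\<close> and \<open>u\<close> are completely joined.\<close>
  have inner': "inner_edges E u v = E\<inverse> `` {v} \<times> E `` {u}"
    using inner * fin by (intro card_subset_eq)
      (auto simp: finite_Image c_def d_def card_cartesian_product)
  \<comment> \<open>A left vertex other than \<open>u\<close> that misses \<open>v\<close> would be
    the end of an outer edge.\<close>
  have D: "Domain E = insert u (E\<inverse> `` {v})"
    using outer uv by (auto simp: outer_edges_def)
  have R: "Range E = insert v (E `` {u})"
    using outer uv by (auto simp: outer_edges_def)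
  show thesis
  proof
    show "u \<in> Domain E" "v \<in> Range E" by fact+
    show "E = Domain E \<times> Range E - {(u, v)}"
    proof
      show "E \<subseteq> Domain E \<times> Range E - {(u, v)}" using uv by auto
      show "Domain E \<times> Range E - {(u, v)} \<subseteq> E"
      proof clarify
        fix i j j' i' assume "(i, j') \<in> E" "(i', j) \<in> E" "(i, j) \<notin> E"
        then have "i \<in> insert u (E\<inverse> `` {v})" "j \<in> insert v (E `` {u})"
          using D R by blast+
        moreover have "\<not> (i \<in> E\<inverse> `` {v} \<and> j \<in> E `` {u})"
          using inner' \<open>(i, j) \<notin> E\<close> by (auto simp: inner_edges_def)
        ultimately show "i = u \<and> j = v" using \<open>(i, j) \<notin> E\<close> by auto
      qed
    qed
    have "card (Domain E) = c + 1" "card (Range E) = d + 1"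
      using uv(3) fin unfolding D R c_def d_def by (auto simp: finite_Image)
    then show "card (Domain E) = n + 1 \<and> card (Range E) = l + 1 \<or> card (Domain E) = l + 1 \<and> card (Range E) = n + 1"
      using * by auto
  qed
qed

section \<open>Spectra of symmetric real matrices and of adjacency matrices\<close>

text \<open>Kept over an arbitrary field, as it serves complex as well as real matrices.\<close>

lemma spectrum_iff:
  fixes A :: "'a :: field mat"
  assumes A: "A \<in> carrier_mat n n"
  shows "k \<in> spectrum A \<longleftrightarrow>
    (\<exists>x. (\<exists>i<n. x i \<noteq> 0) \<and> (\<forall>i<n. (\<Sum>j<n. A $$ (i, j) * x j) = k * x i))"
proof
  assume "k \<in> spectrum A"
  then obtain v where v: "v \<in> carrier_vec n" "v \<noteq> 0\<^sub>v n" "A *\<^sub>v v = k \<cdot>\<^sub>v v"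
    using A unfolding spectrum_def eigenvalue_def eigenvector_def by auto
  have "\<exists>i<n. v $ i \<noteq> 0" using v(1,2) by (metis carrier_vecD eq_vecI index_zero_vec)
  moreover have "(\<Sum>j<n. A $$ (i, j) * v $ j) = k * v $ i" if "i < n" for i
    using arg_cong[OF v(3), of "\<lambda>w. w $ i"] that A v(1)
    by (simp add: scalar_prod_def lessThan_atLeast0)
  ultimately show "\<exists>x. (\<exists>i<n. x i \<noteq> 0) \<and> (\<forall>i<n. (\<Sum>j<n. A $$ (i, j) * x j) = k * x i)"
    by blast
next
  assume "\<exists>x. (\<exists>i<n. x i \<noteq> 0) \<and> (\<forall>i<n. (\<Sum>j<n. A $$ (i, j) * x j) = k * x i)"
  then obtain x i0 where x: "i0 < n" "x i0 \<noteq> 0" "\<And>i. i < n \<Longrightarrow> (\<Sum>j<n. A $$ (i, j) * x j) = k * x i"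
    by blast
  have "vec n x \<noteq> 0\<^sub>v n" using x(1,2) by (metis index_vec index_zero_vec(1))
  moreover have "A *\<^sub>v vec n x = k \<cdot>\<^sub>v vec n x"
    using A x(3) by (intro eq_vecI) (auto simp: scalar_prod_def lessThan_atLeast0)
  ultimately show "k \<in> spectrum A"
    using A unfolding spectrum_def eigenvalue_def eigenvector_def
    by (auto intro!: exI[of _ "vec n x"])
qed

text \<open>Needed so that the \<open>Max\<close> in \<open>lambda_max\<close> is attained. A
  complex eigenvalue \<open>k\<close> exists; symmetry forces \<open>Im k = 0\<close>, and then the
  real or the imaginary part of the eigenvector is a real eigenvector.\<close>

lemma symmetric_real_spectrum_nonempty:
  fixes A :: "real mat"
  assumes A: "A \<in> carrier_mat n n" and n: "n > 0"
    and sym: "\<And>i j. i < n \<Longrightarrow> j < n \<Longrightarrow> A $$ (i, j) = A $$ (j, i)"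
  shows "spectrum A \<noteq> {}"
proof -
  let ?C = "map_mat complex_of_real A"
  have C: "?C \<in> carrier_mat n n" using A by simp
  obtain k where "k \<in> spectrum ?C" using spectrum_non_empty[OF C n] by blast
  then obtain x where x: "\<exists>i<n. x i \<noteq> 0" and "\<And>i. i < n \<Longrightarrow> (\<Sum>j<n. ?C $$ (i, j) * x j) = k * x i"
    unfolding spectrum_iff[OF C] by blast
  then have eq: "(\<Sum>j<n. complex_of_real (A $$ (i, j)) * x j) = k * x i" if "i < n" for i
    using A that by simp
  define a b where "a i = Re (x i)" and "b i = Im (x i)" for i
  have re: "(\<Sum>j<n. A $$ (i, j) * a j) = Re k * a i - Im k * b i" if "i < n" for i
    using arg_cong[OF eq[OF that], of Re] by (simp add: a_def b_def)
  have im: "(\<Sum>j<n. A $$ (i, j) * b j) = Re k * b i + Im k * a i" if "i < n" for i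
    using arg_cong[OF eq[OF that], of Im] by (simp add: a_def b_def)
  \<comment> \<open>Both sides of the resulting identity are the bilinear form of \<open>A\<close>
    at \<open>a\<close> and \<open>b\<close>; comparing them through \<open>re\<close> and
    \<open>im\<close> leaves \<open>Im k\<close> times the squared norm.\<close>
  have "(\<Sum>i<n. b i * (\<Sum>j<n. A $$ (i, j) * a j)) = (\<Sum>i<n. \<Sum>j<n. A $$ (i, j) * (b i * a j))"
    by (simp add: sum_distrib_left algebra_simps)
  also have "\<dots> = (\<Sum>j<n. \<Sum>i<n. A $$ (i, j) * (b i * a j))" by (rule sum.swap)
  also have "\<dots> = (\<Sum>j<n. a j * (\<Sum>i<n. A $$ (j, i) * b i))"
    unfolding sum_distrib_left by (intro sum.cong refl) (use sym in \<open>simp add: algebra_simps\<close>)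
  finally have "(\<Sum>i<n. b i * (Re k * a i - Im k * b i)) = (\<Sum>i<n. a i * (Re k * b i + Im k * a i))"
    by (simp add: re im)
  then have "Im k * (\<Sum>i<n. (a i)\<^sup>2 + (b i)\<^sup>2) = 0"
    by (simp add: algebra_simps sum.distrib sum_subtractf sum_distrib_left power2_eq_square)
  moreover have "(\<Sum>i<n. (a i)\<^sup>2 + (b i)\<^sup>2) > 0"
  proof -
    obtain i where i: "i < n" "x i \<noteq> 0" using x by blast
    then have "(a i)\<^sup>2 + (b i)\<^sup>2 > 0"
      by (metis a_def b_def complex_eq_iff sum_power2_gt_zero_iff zero_complex.sel)
    then show ?thesis using i by (intro sum_pos2[of _ i]) auto
  qed
  ultimately have k: "Im k = 0" by simp
  have "(\<exists>i<n. a i \<noteq> 0) \<or> (\<exists>i<n. b i \<noteq> 0)"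
    using x by (auto simp: a_def b_def complex_eq_iff)
  moreover have "\<forall>i<n. (\<Sum>j<n. A $$ (i, j) * a j) = Re k * a i"
    "\<forall>i<n. (\<Sum>j<n. A $$ (i, j) * b j) = Re k * b i" using re im k by simp_all
  ultimately have "Re k \<in> spectrum A"
    unfolding spectrum_iff[OF A] by blast
  then show ?thesis by blast
qed

lemma vertex_list:
  assumes "finite (pverts G)"
  shows "distinct (vertex_list G)" "set (vertex_list G) = pverts G"
    "length (vertex_list G) = card (pverts G)"
proof -
  have "\<exists>vs. distinct vs \<and> set vs = pverts G" using finite_distinct_list[OF assms] by blast
  from someI_ex[OF this] have "distinct (vertex_list G) \<and> set (vertex_list G) = pverts G"
    by (simp add: vertex_list_def)
  moreover from this have "length (vertex_list G) = card (pverts G)"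
    using distinct_card[of "vertex_list G"] by simp
  ultimately show "distinct (vertex_list G)" "set (vertex_list G) = pverts G"
    "length (vertex_list G) = card (pverts G)" by simp_all
qed

lemma adjacency_matrix_carrier: "adjacency_matrix G \<in> carrier_mat (card (pverts G)) (card (pverts G))"
  by (simp add: adjacency_matrix_def)

text \<open>Eigenvectors as functions on vertices, which removes the arbitrary order of
  \<open>vertex_list\<close>.\<close>

definition graph_eigenfunction :: "'a pair_pre_digraph \<Rightarrow> real \<Rightarrow> ('a \<Rightarrow> real) \<Rightarrow> bool" where
  "graph_eigenfunction G k f \<longleftrightarrow> (\<exists>u\<in>pverts G. f u \<noteq> 0) \<and>
     (\<forall>u\<in>pverts G. (\<Sum>v | v \<in> pverts G \<and> (u, v) \<in> parcs G. f v) = k * f u)"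

lemma spectrum_adjacency_matrix:
  assumes fin: "finite (pverts G)"
  shows "k \<in> spectrum (adjacency_matrix G) \<longleftrightarrow> (\<exists>f. graph_eigenfunction G k f)"
proof -
  define n vs where "n = card (pverts G)" and "vs = vertex_list G"
  have bij: "bij_betw ((!) vs) {..<n} (pverts G)"
    unfolding n_def vs_def using vertex_list[OF fin] by (intro bij_betw_nth) simp_all
  have verts: "(\<forall>u\<in>pverts G. P u) \<longleftrightarrow> (\<forall>i<n. P (vs ! i))"
    "(\<exists>u\<in>pverts G. P u) \<longleftrightarrow> (\<exists>i<n. P (vs ! i))" for P
    unfolding bij_betw_imp_surj_on[OF bij, symmetric] by auto
  have A: "adjacency_matrix G $$ (i, j) = (if (vs ! i, vs ! j) \<in> parcs G then 1 else 0)"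
    if "i < n" "j < n" for i j
    using that by (simp add: adjacency_matrix_def n_def vs_def)
  have row: "(\<Sum>j<n. adjacency_matrix G $$ (i, j) * f (vs ! j))
      = (\<Sum>v | v \<in> pverts G \<and> (vs ! i, v) \<in> parcs G. f v)" if "i < n" for i f
  proof -
    have "(\<Sum>j<n. adjacency_matrix G $$ (i, j) * f (vs ! j))
        = (\<Sum>j<n. if (vs ! i, vs ! j) \<in> parcs G then f (vs ! j) else 0)"
      using that by (intro sum.cong) (auto simp: A)
    also have "\<dots> = (\<Sum>v\<in>pverts G. if (vs ! i, v) \<in> parcs G then f v else 0)"
      by (rule sum.reindex_bij_betw[OF bij])
    finally show ?thesis using fin by (simp add: sum.inter_filter)
  qed
  show ?thesis
  proof
    assume "k \<in> spectrum (adjacency_matrix G)"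
    then obtain x where x: "\<exists>i<n. x i \<noteq> 0"
      "\<forall>i<n. (\<Sum>j<n. adjacency_matrix G $$ (i, j) * x j) = k * x i"
      unfolding spectrum_iff[OF adjacency_matrix_carrier] n_def by blast
    define f where "f = x \<circ> the_inv_into {..<n} ((!) vs)"
    have f: "f (vs ! i) = x i" if "i < n" for i
      using that bij by (simp add: f_def bij_betw_def the_inv_into_f_f)
    have "\<exists>i<n. f (vs ! i) \<noteq> 0" using x(1) f by auto
    moreover have "(\<Sum>v | v \<in> pverts G \<and> (vs ! i, v) \<in> parcs G. f v) = k * f (vs ! i)" if "i < n" for i
      using x(2) that f row[OF that, of f, symmetric] by simp
    ultimately have "graph_eigenfunction G k f"
      unfolding graph_eigenfunction_def verts by simp
    then show "\<exists>f. graph_eigenfunction G k f" by blast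
  next
    assume "\<exists>f. graph_eigenfunction G k f"
    then obtain f where f: "graph_eigenfunction G k f" by blast
    have "\<exists>i<n. f (vs ! i) \<noteq> 0"
      using f by (simp add: graph_eigenfunction_def verts)
    moreover have "\<forall>i<n. (\<Sum>j<n. adjacency_matrix G $$ (i, j) * f (vs ! j)) = k * f (vs ! i)"
      using f row by (simp add: graph_eigenfunction_def verts)
    ultimately show "k \<in> spectrum (adjacency_matrix G)"
      unfolding spectrum_iff[OF adjacency_matrix_carrier] n_def[symmetric]
      by (intro exI[of _ "\<lambda>i. f (vs ! i)"]) blast
  qed
qed

lemma finite_spectrum_adjacency_matrix: "finite (spectrum (adjacency_matrix G))"
  by (rule card_finite_spectrum(1)[OF adjacency_matrix_carrier])

lemma graph_eigenfunction_le_lambda_max: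
  assumes "finite (pverts G)" "graph_eigenfunction G k f"
  shows "k \<le> lambda_max G"
  unfolding lambda_max_def using assms finite_spectrum_adjacency_matrix
  by (intro Max_ge) (auto simp: spectrum_adjacency_matrix)

lemma lambda_max_eigenfunction:
  assumes fin: "finite (pverts G)" and ne: "pverts G \<noteq> {}" and sym: "sym (parcs G)"
  obtains f where "graph_eigenfunction G (lambda_max G) f"
proof -
  have "spectrum (adjacency_matrix G) \<noteq> {}"
  proof (rule symmetric_real_spectrum_nonempty[OF adjacency_matrix_carrier])
    show "card (pverts G) > 0" using fin ne by (simp add: card_gt_0_iff)
  qed (use sym in \<open>auto simp: adjacency_matrix_def dest: symD\<close>)
  then have "lambda_max G \<in> spectrum (adjacency_matrix G)"
    unfolding lambda_max_def by (intro Max_in finite_spectrum_adjacency_matrix)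
  then show thesis using that spectrum_adjacency_matrix[OF fin] by blast
qed

section \<open>Isomorphism invariance\<close>

text \<open>Arcs are pairs of vertices with \<open>fst\<close> and \<open>snd\<close> as tail and
  head, so the vertex map determines the arc map.\<close>

lemma digraph_iso_pair_iff:
  assumes wf: "pair_wf_digraph G"
  shows "digraph_iso (with_proj G) (with_proj H) \<longleftrightarrow>
    (\<exists>h. inj_on h (pverts G) \<and> pverts H = h ` pverts G \<and> parcs H = map_prod h h ` parcs G)"
    (is "?L \<longleftrightarrow> ?R")
proof
  assume ?L
  then obtain f where f: "pre_digraph.digraph_isomorphism (with_proj G) f"
    and H: "with_proj H = app_iso f (with_proj G)"
    unfolding digraph_iso_def by blast
  let ?h = "iso_verts f"
  have proj: "iso_tail f = fst" "iso_head f = snd"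
    using arg_cong[OF H, of tail] arg_cong[OF H, of head] by simp_all
  have "iso_arcs f a = map_prod ?h ?h a" if "a \<in> parcs G" for a
    using f that unfolding pre_digraph.digraph_isomorphism_def by (auto simp: proj prod_eq_iff)
  then have "parcs H = map_prod ?h ?h ` parcs G"
    using arg_cong[OF H, of arcs] by (simp cong: image_cong)
  moreover have "pverts H = ?h ` pverts G" using arg_cong[OF H, of verts] by simp
  moreover have "inj_on ?h (pverts G)"
    using f unfolding pre_digraph.digraph_isomorphism_def by simp
  ultimately show ?R by blast
next
  assume ?R
  then obtain h where h: "inj_on h (pverts G)" "pverts H = h ` pverts G" "parcs H = map_prod h h ` parcs G"
    by blast
  interpret pair_wf_digraph G by fact
  have "inj_on (map_prod h h) (pverts G \<times> pverts G)"
    by (rule map_prod_inj_on[OF h(1) h(1)])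
  then have "inj_on (map_prod h h) (parcs G)"
    by (rule inj_on_subset) (auto dest: in_arcsD1 in_arcsD2)
  then have "digraph_isomorphism \<lparr>iso_verts = h, iso_arcs = map_prod h h, iso_head = snd, iso_tail = fst\<rparr>"
    unfolding digraph_isomorphism_def using h(1) wf_digraph_axioms by simp
  moreover have "with_proj H = app_iso \<lparr>iso_verts = h, iso_arcs = map_prod h h, iso_head = snd, iso_tail = fst\<rparr> (with_proj G)"
    by (simp add: with_proj_def app_iso_def h)
  ultimately show ?L unfolding digraph_iso_def by blast
qed

lemma graph_eigenfunction_transport:
  assumes inj: "inj_on h (pverts G)" and V: "pverts H = h ` pverts G"
    and A: "parcs H = map_prod h h ` parcs G" and wf: "parcs G \<subseteq> pverts G \<times> pverts G"
  shows "graph_eigenfunction H k f \<longleftrightarrow> graph_eigenfunction G k (f \<circ> h)"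
proof -
  have arc: "(h u, h v) \<in> parcs H \<longleftrightarrow> (u, v) \<in> parcs G" if "u \<in> pverts G" "v \<in> pverts G" for u v
  proof
    assume "(h u, h v) \<in> parcs H"
    then obtain u' v' where "(u', v') \<in> parcs G" "h u = h u'" "h v = h v'" unfolding A by auto
    then show "(u, v) \<in> parcs G" using inj wf that by (metis inj_onD mem_Sigma_iff subsetD)
  qed (auto simp: A intro: rev_image_eqI)
  have "(\<Sum>w | w \<in> pverts H \<and> (h u, w) \<in> parcs H. f w) = (\<Sum>v | v \<in> pverts G \<and> (u, v) \<in> parcs G. f (h v))"
    if "u \<in> pverts G" for u
  proof -
    have "{w. w \<in> pverts H \<and> (h u, w) \<in> parcs H} = h ` {v. v \<in> pverts G \<and> (u, v) \<in> parcs G}"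
      using arc[OF that] by (auto simp: V)
    moreover have "inj_on h {v. v \<in> pverts G \<and> (u, v) \<in> parcs G}"
      using inj by (rule inj_on_subset) auto
    ultimately show ?thesis by (simp add: sum.reindex)
  qed
  then show ?thesis by (simp add: graph_eigenfunction_def V)
qed

lemma lambda_max_cong_iso:
  assumes wf: "pair_wf_digraph G" and fin: "finite (pverts G)"
    and iso: "digraph_iso (with_proj G) (with_proj H)"
  shows "lambda_max G = lambda_max H"
proof -
  obtain h where h: "inj_on h (pverts G)" "pverts H = h ` pverts G" "parcs H = map_prod h h ` parcs G"
    using iso unfolding digraph_iso_pair_iff[OF wf] by blast
  have wf': "parcs G \<subseteq> pverts G \<times> pverts G"
    using wf by (auto simp: pair_wf_digraph_def)
  note tr = graph_eigenfunction_transport[OF h wf']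
  have "(\<exists>f. graph_eigenfunction H k f) \<longleftrightarrow> (\<exists>f. graph_eigenfunction G k f)" for k
  proof
    assume "\<exists>f. graph_eigenfunction G k f"
    then obtain f where f: "graph_eigenfunction G k f" by blast
    \<comment> \<open>Eigenfunctions of \<open>G\<close> are pulled back along the inverse of
      \<open>h\<close>, which cancels on the vertices of \<open>G\<close>.\<close>
    have "graph_eigenfunction G k ((f \<circ> the_inv_into (pverts G) h) \<circ> h) \<longleftrightarrow> graph_eigenfunction G k f"
      using h(1) by (auto simp: graph_eigenfunction_def the_inv_into_f_f)
    then show "\<exists>f. graph_eigenfunction H k f" using tr f by blast
  qed (use tr in blast)
  moreover have "finite (pverts H)" using fin h(2) by simp
  ultimately have "spectrum (adjacency_matrix G) = spectrum (adjacency_matrix H)"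
    using fin by (simp add: set_eq_iff spectrum_adjacency_matrix)
  then show ?thesis by (simp add: lambda_max_def)
qed

section \<open>The fourth power bound on eigenvalues\<close>

text \<open>Once the left ends \<open>i\<close>, \<open>i'\<close> are fixed, the right ends range
  independently over the common neighbours. The sum is the squared Frobenius norm of
  \<open>M M^T\<close>.\<close>

lemma card_rectangles:
  assumes fin: "finite E"
  shows "card (rectangles E) = (\<Sum>i\<in>Domain E. \<Sum>i'\<in>Domain E. (card (E `` {i} \<inter> E `` {i'}))\<^sup>2)"
proof -
  let ?C = "\<lambda>z. E `` {fst z} \<inter> E `` {snd z}"
  let ?\<phi> = "\<lambda>((i, i'), (j, j')). ((i, j), (i', j'))"
  have finC: "finite (?C z)" for z using fin by (simp add: finite_Image)
  have "bij_betw ?\<phi> (Sigma (Domain E \<times> Domain E) (\<lambda>z. ?C z \<times> ?C z)) (rectangles E)"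
    by (rule bij_betw_byWitness[of _ "\<lambda>((i, j), (i', j')). ((i, i'), (j, j'))"])
      (auto simp: rectangles_def)
  then have "card (rectangles E) = card (Sigma (Domain E \<times> Domain E) (\<lambda>z. ?C z \<times> ?C z))"
    by (simp add: bij_betw_same_card)
  also have "\<dots> = (\<Sum>z\<in>Domain E \<times> Domain E. (card (?C z))\<^sup>2)"
    using fin finC by (subst card_SigmaI) (auto simp: finite_Domain card_cartesian_product power2_eq_square)
  finally show ?thesis by (simp add: sum.cartesian_product split_def)
qed

text \<open>Two steps along the graph show that \<open>k\<^sup>2\<close> is an eigenvalue of the
  matrix \<open>C\<close> of common neighbour counts, with eigenvector the restriction of
  \<open>f\<close> to the left side. By Cauchy-Schwarz its square is at most the squared Frobenius
  norm of \<open>C\<close>.\<close>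

lemma eigenvalue_pow4_le_rectangles:
  assumes fin: "finite E" and disj: "Domain E \<inter> Range E = {}"
    and V: "pverts G = Domain E \<union> Range E" and A: "parcs G = E \<union> E\<inverse>"
    and eig: "graph_eigenfunction G k f"
  shows "k ^ 4 \<le> real (card (rectangles E))"
proof (cases "k = 0")
  case False
  let ?D = "Domain E"
  have finD: "finite ?D" using fin by (simp add: finite_Domain)
  have row: "(\<Sum>j\<in>E `` {i}. f j) = k * f i" if "i \<in> ?D" for i
  proof -
    have "{v. v \<in> pverts G \<and> (i, v) \<in> parcs G} = E `` {i}" using disj that by (auto simp: V A)
    moreover have "i \<in> pverts G" using that V by simp
    ultimately show ?thesis using eig[unfolded graph_eigenfunction_def] by metis
  qed
  have col: "(\<Sum>i\<in>E\<inverse> `` {j}. f i) = k * f j" if "j \<in> Range E" for j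
  proof -
    have "{v. v \<in> pverts G \<and> (j, v) \<in> parcs G} = E\<inverse> `` {j}" using disj that by (auto simp: V A)
    moreover have "j \<in> pverts G" using that V by simp
    ultimately show ?thesis using eig[unfolded graph_eigenfunction_def] by metis
  qed
  define C where "C i i' = real (card (E `` {i} \<inter> E `` {i'}))" for i i'
  have step: "k\<^sup>2 * f i = (\<Sum>i'\<in>?D. C i i' * f i')" if "i \<in> ?D" for i
  proof -
    have "k\<^sup>2 * f i = (\<Sum>j\<in>E `` {i}. k * f j)"
      using row[OF that] by (simp add: power2_eq_square sum_distrib_left[symmetric])
    also have "\<dots> = (\<Sum>j\<in>E `` {i}. \<Sum>i'\<in>?D. if (i', j) \<in> E then f i' else 0)"
    proof (intro sum.cong refl)
      fix j assume "j \<in> E `` {i}"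
      then have "k * f j = (\<Sum>i'\<in>E\<inverse> `` {j}. f i')" using col[of j] by (metis Image_singleton_iff RangeI)
      also have "E\<inverse> `` {j} = {i' \<in> ?D. (i', j) \<in> E}" by auto
      finally show "k * f j = (\<Sum>i'\<in>?D. if (i', j) \<in> E then f i' else 0)"
        using finD by (simp add: sum.inter_filter)
    qed
    also have "\<dots> = (\<Sum>i'\<in>?D. \<Sum>j\<in>E `` {i}. if (i', j) \<in> E then f i' else 0)"
      by (rule sum.swap)
    also have "\<dots> = (\<Sum>i'\<in>?D. C i i' * f i')"
    proof (intro sum.cong refl)
      fix i'
      have "E `` {i} \<inter> E `` {i'} = {j \<in> E `` {i}. (i', j) \<in> E}" by auto
      then show "(\<Sum>j\<in>E `` {i}. if (i', j) \<in> E then f i' else 0) = C i i' * f i'"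
        using fin by (simp add: C_def sum.inter_filter[symmetric] finite_Image)
    qed
    finally show ?thesis .
  qed
  define S where "S = (\<Sum>i\<in>?D. (f i)\<^sup>2)"
  have "S > 0"
  proof -
    \<comment> \<open>As \<open>k\<close> is nonzero, an eigenfunction vanishing on the left would
      vanish on the right as well.\<close>
    have "\<exists>i\<in>?D. f i \<noteq> 0"
    proof (rule ccontr)
      assume 0: "\<not> (\<exists>i\<in>?D. f i \<noteq> 0)"
      have "f j = 0" if "j \<in> Range E" for j
      proof -
        have "(\<Sum>i\<in>E\<inverse> `` {j}. f i) = 0" using 0 by (intro sum.neutral) auto
        then show ?thesis using col[OF that] False by simp
      qed
      then show False using 0 eig by (auto simp: graph_eigenfunction_def V)
    qed
    then obtain i where "i \<in> ?D" "f i \<noteq> 0" by blast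
    then show ?thesis unfolding S_def using finD by (intro sum_pos2[of _ i]) auto
  qed
  have "k ^ 4 * S = (\<Sum>i\<in>?D. (k\<^sup>2 * f i)\<^sup>2)"
    by (simp add: S_def sum_distrib_left power_mult_distrib flip: power_mult)
  also have "\<dots> = (\<Sum>i\<in>?D. (\<Sum>i'\<in>?D. C i i' * f i')\<^sup>2)"
    by (intro sum.cong refl) (simp add: step)
  also have "\<dots> \<le> (\<Sum>i\<in>?D. (\<Sum>i'\<in>?D. (C i i')\<^sup>2) * S)"
    unfolding S_def by (intro sum_mono Cauchy_Schwarz_ineq_sum)
  also have "\<dots> = real (card (rectangles E)) * S"
    by (simp add: card_rectangles[OF fin] C_def sum_distrib_right)
  finally show ?thesis using \<open>S > 0\<close> by simp
qed simp

section \<open>The largest eigenvalue of the extremal graph\<close>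

lemma pverts_extremal_graph: "pverts (extremal_graph (Suc n) l) = Inl ` {..n} \<union> Inr ` {..l}"
  by (auto simp: extremal_graph_def complete_bipartite_graph_def Let_def)

lemma parcs_extremal_graph:
  "parcs (extremal_graph (Suc n) l) =
    (let F = Inl ` {..n} \<times> Inr ` {..l} - {(Inl n, Inr l)} in F \<union> F\<inverse>)"
proof (rule Set.set_eqI)
  fix z :: "(nat + nat) \<times> (nat + nat)"
  obtain x y where "z = (x, y)" by (cases z)
  then show "z \<in> parcs (extremal_graph (Suc n) l) \<longleftrightarrow>
      z \<in> (let F = Inl ` {..n} \<times> Inr ` {..l} - {(Inl n, Inr l)} in F \<union> F\<inverse>)"
    by (cases x; cases y)
      (auto simp: extremal_graph_def complete_bipartite_graph_def Let_def image_iff less_Suc_eq_le le_less)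
qed

text \<open>An explicit eigenfunction, constant on the four classes of vertices: the
  \<open>n\<close> full left vertices, the added one, the \<open>l\<close> full right vertices, and
  the last one.\<close>

lemma lambda_max_extremal_graph:
  fixes n l :: nat
  assumes l: "1 \<le> l" and \<rho>: "0 < \<rho>" "\<rho>\<^sup>2 = real (n * l + l + n) * \<rho> - real (n * l)"
  shows "sqrt \<rho> \<le> lambda_max (extremal_graph (Suc n) l)"
proof -
  let ?H = "extremal_graph (Suc n) l"
  define \<sigma> where "\<sigma> = sqrt \<rho>"
  have \<sigma>: "\<sigma> > 0" "\<sigma> * \<sigma> = \<rho>" using \<rho> by (simp_all add: \<sigma>_def)
  \<comment> \<open>Put \<sigma> on the full left vertices. The equation at \<open>Inr l\<close>
    then gives \<open>n\<close>, that at a full left vertex gives \<open>(\<rho> - n) / l\<close> on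
    the full right vertices, and that at \<open>Inl n\<close> gives
    \<open>(\<rho> - n) / \<sigma>\<close>. The remaining equation, at a full right vertex, is the
    quadratic assumed for \<rho>.\<close>
  define f where "f = case_sum (\<lambda>i. if i < n then \<sigma> else (\<rho> - n) / \<sigma>) (\<lambda>j. if j < l then (\<rho> - n) / l else real n)"
  have F: "(Inl i, Inr j) \<in> parcs ?H \<longleftrightarrow> i \<le> n \<and> j \<le> l \<and> (i, j) \<noteq> (n, l)"
    "(Inr j, Inl i) \<in> parcs ?H \<longleftrightarrow> i \<le> n \<and> j \<le> l \<and> (i, j) \<noteq> (n, l)"
    "(Inl i, Inl i') \<notin> parcs ?H" "(Inr j, Inr j') \<notin> parcs ?H" for i j i' j'
    by (auto simp: parcs_extremal_graph Let_def)
  let ?S = "\<lambda>u. \<Sum>v | v \<in> pverts ?H \<and> (u, v) \<in> parcs ?H. f v"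
  have lastl: "{..l} = insert l {..<l}" and lastn: "{..n} = insert n {..<n}" by auto
  have 1: "?S (Inl i) = \<sigma> * f (Inl i)" if "i < n" for i
  proof -
    have "{v. v \<in> pverts ?H \<and> (Inl i, v) \<in> parcs ?H} = Inr ` {..l}"
      using that by (auto simp: pverts_extremal_graph F)
    then have "?S (Inl i) = (\<Sum>j\<le>l. f (Inr j))" by (simp add: sum.reindex)
    then show ?thesis using that l \<sigma> by (simp add: f_def lastl)
  qed
  have 2: "?S (Inl n) = \<sigma> * f (Inl n)"
  proof -
    have "{v. v \<in> pverts ?H \<and> (Inl n, v) \<in> parcs ?H} = Inr ` {..<l}"
      by (auto simp: pverts_extremal_graph F)
    then show ?thesis using l \<sigma> by (simp add: sum.reindex f_def)
  qed
  have 3: "?S (Inr j) = \<sigma> * f (Inr j)" if "j < l" for j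
  proof -
    have "{v. v \<in> pverts ?H \<and> (Inr j, v) \<in> parcs ?H} = Inl ` {..n}"
      using that by (auto simp: pverts_extremal_graph F)
    then have "?S (Inr j) = (\<Sum>i\<le>n. f (Inl i))" by (simp add: sum.reindex)
    also have "\<dots> = n * \<sigma> + (\<rho> - n) / \<sigma>" by (simp add: f_def lastn)
    also have "\<dots> = \<sigma> * ((\<rho> - n) / l)"
    proof -
      have "(n * \<rho> + (\<rho> - n)) * l = \<rho> * (\<rho> - n)"
        using \<rho>(2) by (simp add: algebra_simps power2_eq_square)
      then have "(n * (\<sigma> * \<sigma>) + (\<rho> - n)) * l = \<sigma> * \<sigma> * (\<rho> - n)" by (simp only: \<sigma>)
      then show ?thesis using \<sigma>(1) l by (simp add: field_simps)
    qed
    finally show ?thesis using that by (simp add: f_def)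
  qed
  have 4: "?S (Inr l) = \<sigma> * f (Inr l)"
  proof -
    have "{v. v \<in> pverts ?H \<and> (Inr l, v) \<in> parcs ?H} = Inl ` {..<n}"
      by (auto simp: pverts_extremal_graph F)
    then show ?thesis by (simp add: sum.reindex f_def)
  qed
  have "?S u = \<sigma> * f u" if "u \<in> pverts ?H" for u
    using that 1 2 3 4 unfolding pverts_extremal_graph by (auto simp: le_less)
  moreover have "\<exists>u\<in>pverts ?H. f u \<noteq> 0"
  proof (cases "n = 0")
    case True
    then have "f (Inl n) \<noteq> 0" using \<sigma> \<rho> by (simp add: f_def)
    then show ?thesis by (auto simp: pverts_extremal_graph)
  next
    case False
    then have "f (Inr l) \<noteq> 0" by (simp add: f_def)
    then show ?thesis by (auto simp: pverts_extremal_graph)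
  qed
  ultimately have "graph_eigenfunction ?H \<sigma> f" by (simp add: graph_eigenfunction_def)
  then show ?thesis
    unfolding \<sigma>_def by (intro graph_eigenfunction_le_lambda_max) (simp add: pverts_extremal_graph)
qed

text \<open>
  The largest root \<open>\<rho>\<close> of \<open>t\<^sup>2 - e t + n l\<close> satisfies \<open>\<rho>\<^sup>2 + (e - \<rho>)\<^sup>2 = e\<^sup>2 - 2 n l\<close>, and
  \<open>e - \<rho> < 1\<close> because \<open>n l < e - 1\<close>.
\<close>

lemma lambda_max_extremal_graph_pow4:
  fixes n l :: nat
  assumes n: "1 \<le> n" and l: "2 \<le> l"
  defines "e \<equiv> real (n * l + l + n)"
  shows "e\<^sup>2 - 2 * real (n * l) - 1 < lambda_max (extremal_graph (Suc n) l) ^ 4"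
    and "0 < lambda_max (extremal_graph (Suc n) l)"
proof -
  let ?m = "real (n * l)" and ?H = "extremal_graph (Suc n) l"
  define s where "s = sqrt (e\<^sup>2 - 4 * ?m)"
  have e: "e \<ge> ?m + 3" using n l by (simp add: e_def)
  then have e3: "e \<ge> 3" using of_nat_0_le_iff[of "n * l", where 'a = real] by linarith
  have pos: "(e - 2)\<^sup>2 < e\<^sup>2 - 4 * ?m" using e by (simp add: power2_eq_square algebra_simps)
  have "e - 2 < s" unfolding s_def using pos by (rule real_less_rsqrt)
  have "s \<le> e" unfolding s_def using e by (intro real_le_lsqrt) (auto simp: e_def)
  have s2: "s\<^sup>2 = e\<^sup>2 - 4 * ?m" unfolding s_def
    using pos by (intro real_sqrt_pow2) (use zero_le_power2[of "e - 2"] in linarith)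
  define \<rho> where "\<rho> = (e + s) / 2"
  have \<rho>: "e - 1 < \<rho>" "\<rho> \<le> e" "0 < \<rho>"
    using \<open>e - 2 < s\<close> \<open>s \<le> e\<close> e3 by (simp_all add: \<rho>_def)
  have q: "\<rho>\<^sup>2 = e * \<rho> - ?m"
    using s2 by (simp add: \<rho>_def power2_eq_square field_simps)
  have le: "sqrt \<rho> \<le> lambda_max ?H"
    using lambda_max_extremal_graph[of l \<rho> n] l \<rho>(3) q by (simp add: e_def)
  then show "0 < lambda_max ?H" using \<rho>(3) by (meson less_le_trans real_sqrt_gt_zero)
  have "(e - \<rho>)\<^sup>2 < 1" using \<rho> by (simp add: power2_eq_square abs_square_less_1[unfolded power2_eq_square])
  then have "e\<^sup>2 - 2 * ?m - 1 < \<rho>\<^sup>2" using q by (simp add: power2_eq_square algebra_simps)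
  also have "\<rho>\<^sup>2 = sqrt \<rho> ^ 4"
    using \<rho>(3) power_mult[of "sqrt \<rho>" 2 2] by simp
  also have "\<dots> \<le> lambda_max ?H ^ 4" using le \<rho>(3) by (intro power_mono) auto
  finally show "e\<^sup>2 - 2 * ?m - 1 < lambda_max ?H ^ 4" .
qed

section \<open>Recognising the extremal graph\<close>

text \<open>The prescribed vertex is numbered last because the missing edge of the extremal graph
  joins the last vertices of both sides.\<close>

lemma bij_betw_atMost_last:
  assumes "card A = Suc n" "u \<in> A"
  obtains \<alpha> where "bij_betw \<alpha> A {..n}" "\<alpha> u = n"
proof -
  have "finite A" using assms(1) card.infinite by fastforce
  then have "card (A - {u}) = card {..<n}" "finite (A - {u})" using assms by simp_all
  then obtain \<beta> where \<beta>: "bij_betw \<beta> (A - {u}) {..<n}"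
    by (metis finite_lessThan finite_same_card_bij)
  define \<alpha> where "\<alpha> = \<beta>(u := n)"
  have "bij_betw \<alpha> (A - {u}) {..<n}"
    using \<beta> by (subst bij_betw_cong[of _ _ \<beta>]) (auto simp: \<alpha>_def)
  then have "bij_betw \<alpha> ((A - {u}) \<union> {u}) ({..<n} \<union> {\<alpha> u})"
    by (subst notIn_Un_bij_betw3[symmetric]) (auto simp: \<alpha>_def)
  moreover have "(A - {u}) \<union> {u} = A" "{..<n} \<union> {\<alpha> u} = {..n}" using assms(2) by (auto simp: \<alpha>_def)
  ultimately show thesis using that[of \<alpha>] by (simp add: \<alpha>_def)
qed

lemma iso_extremal_graph:
  assumes disj: "A \<inter> B = {}" and V: "pverts G = A \<union> B"
    and arcs: "parcs G = (A \<times> B - {(u, v)}) \<union> (A \<times> B - {(u, v)})\<inverse>"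
    and uv: "u \<in> A" "v \<in> B" and card: "card A = Suc n" "card B = Suc l"
  shows "digraph_iso (with_proj G) (with_proj (extremal_graph (Suc n) l))"
proof -
  obtain \<alpha> where \<alpha>: "bij_betw \<alpha> A {..n}" "\<alpha> u = n" using bij_betw_atMost_last card(1) uv(1) .
  obtain \<beta> where \<beta>: "bij_betw \<beta> B {..l}" "\<beta> v = l" using bij_betw_atMost_last card(2) uv(2) .
  define h where "h x = (if x \<in> A then Inl (\<alpha> x) else Inr (\<beta> x))" for x
  have hA: "h x = Inl (\<alpha> x)" if "x \<in> A" for x using that by (simp add: h_def)
  have hB: "h x = Inr (\<beta> x)" if "x \<in> B" for x using that disj by (auto simp: h_def)
  have inj: "inj_on h (A \<union> B)"
    unfolding inj_on_Un
    using bij_betw_imp_inj_on[OF \<alpha>(1)] bij_betw_imp_inj_on[OF \<beta>(1)]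
    by (auto simp: inj_on_def hA hB)
  have imA: "h ` A = Inl ` {..n}"
    using bij_betw_imp_surj_on[OF \<alpha>(1)] by (simp add: hA image_image[symmetric] cong: image_cong)
  have imB: "h ` B = Inr ` {..l}"
    using bij_betw_imp_surj_on[OF \<beta>(1)] by (simp add: hB image_image[symmetric] cong: image_cong)
  let ?F = "A \<times> B - {(u, v)}" and ?F' = "Inl ` {..n} \<times> Inr ` {..l} - {(Inl n, Inr l)}"
  have "inj_on (map_prod h h) (A \<times> B)"
    using map_prod_inj_on[OF inj inj] by (rule inj_on_subset) auto
  then have "map_prod h h ` ?F = map_prod h h ` (A \<times> B) - map_prod h h ` {(u, v)}"
    using uv by (intro inj_on_image_set_diff) auto
  also have "map_prod h h ` (A \<times> B) = h ` A \<times> h ` B" by force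
  finally have F: "map_prod h h ` ?F = ?F'"
    by (simp only: imA imB image_insert image_empty map_prod_simp hA[OF uv(1)] hB[OF uv(2)] \<alpha>(2) \<beta>(2))
  have "map_prod h h ` (?F\<inverse>) = (map_prod h h ` ?F)\<inverse>" by force
  then have "parcs (extremal_graph (Suc n) l) = map_prod h h ` parcs G"
    unfolding parcs_extremal_graph arcs image_Un Let_def F by simp
  moreover have "pverts (extremal_graph (Suc n) l) = h ` pverts G"
    by (simp add: pverts_extremal_graph V image_Un imA imB)
  moreover have "pair_wf_digraph G"
    by unfold_locales (auto simp: arcs V)
  ultimately show ?thesis
    using inj V by (auto simp: digraph_iso_pair_iff)
qed

section \<open>From the family to relations, and the comparison\<close>

text \<open>\<open>E\<close> keeps of each edge the arc from the \<open>p\<close>-side to the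
  \<open>q\<close>-side of the ambient graph. The absence of isolated vertices makes domain and
  range exhaust the vertices.\<close>

lemma bipartite_family_edges:
  assumes "G \<in> bipartite_family p q e"
  obtains E where "finite E" "Domain E \<inter> Range E = {}" "pverts G = Domain E \<union> Range E"
    "parcs G = E \<union> E\<inverse>" "card E = e" "card (Domain E) \<le> p" "card (Range E) \<le> q"
    "E \<noteq> Domain E \<times> Range E"
proof -
  from assms obtain H where G: "pair_graph G" and H: "complete_bipartite_digraph p q (with_proj H)"
    and sub: "subgraph (with_proj G) (with_proj H)"
    and e: "card (edge_set G) = e" and iso: "\<And>u. u \<in> pverts G \<Longrightarrow> \<exists>v. (u, v) \<in> parcs G"
    and nc: "\<And>m n. \<not> complete_bipartite_digraph m n (with_proj G)"
    unfolding bipartite_family_def by blast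
  interpret G: pair_graph G by (rule G)
  obtain U V where UV: "finite (pverts H)" "pverts H = U \<union> V" "U \<inter> V = {}" "card U = p" "card V = q"
    "parcs H = U \<times> V \<union> V \<times> U"
    using H unfolding complete_bipartite_digraph_pair_def by blast
  have subset: "parcs G \<subseteq> U \<times> V \<union> V \<times> U" using sub UV(6) by (simp add: subgraph_def)
  have sym: "(v, u) \<in> parcs G" if "(u, v) \<in> parcs G" for u v
    using G.pair_sym_arcs that by (rule arcs_ends_symmetric[of "with_proj G", simplified])
  define E where "E = parcs G \<inter> U \<times> V"
  have fin: "finite E" unfolding E_def using G.pair_finite_arcs by simp
  have EU: "Domain E \<subseteq> U" "Range E \<subseteq> V" by (auto simp: E_def)
  have disj: "Domain E \<inter> Range E = {}" using EU UV(3) by blast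
  have arcs: "parcs G = E \<union> E\<inverse>" using subset sym by (auto simp: E_def)
  have verts: "pverts G = Domain E \<union> Range E"
  proof
    show "pverts G \<subseteq> Domain E \<union> Range E" using iso unfolding arcs by blast
    show "Domain E \<union> Range E \<subseteq> pverts G"
      using G.in_arcsD1 G.in_arcsD2 unfolding arcs by blast
  qed
  have "edge_set G = (\<lambda>(u, v). {u, v}) ` E"
    unfolding edge_set_def arcs by (auto simp: insert_commute image_iff) 
  \<comment> \<open>The sides are disjoint, so an unordered edge determines its orientation.\<close>
  moreover have "inj_on (\<lambda>(u, v). {u, v}) E"
    using disj by (fastforce simp: inj_on_def doubleton_eq_iff)
  ultimately have "card E = e" using e by (simp add: card_image)
  moreover have "card (Domain E) \<le> p" "card (Range E) \<le> q"
    using EU UV by (auto intro!: card_mono)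
  moreover have "E \<noteq> Domain E \<times> Range E"
  proof
    assume "E = Domain E \<times> Range E"
    then have "parcs G = Domain E \<times> Range E \<union> Range E \<times> Domain E" unfolding arcs by blast
    then have "complete_bipartite_digraph (card (Domain E)) (card (Range E)) (with_proj G)"
      unfolding complete_bipartite_digraph_pair_def using G.pair_finite_verts verts disj by blast
    then show False using nc by blast
  qed
  ultimately show thesis using that[of E] fin disj verts arcs by blast
qed

text \<open>Few defects make \<open>G\<close> isomorphic to the extremal graph. Otherwise the
  inequality is strict, which also rules out an isomorphism.\<close>

theorem lambda_max_le_extremal_graph:
  assumes E: "finite E" "Domain E \<inter> Range E = {}" "pverts G = Domain E \<union> Range E"
    "parcs G = E \<union> E\<inverse>"
    and n: "1 \<le> n" "n \<le> l" "2 \<le> l" and e: "card E = n * l + l + n"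
    and sides: "n < card (Domain E)" "n < card (Range E)"
    and nc: "E \<noteq> Domain E \<times> Range E"
  shows "lambda_max G \<le> lambda_max (extremal_graph (Suc n) l) \<and>
         (lambda_max G = lambda_max (extremal_graph (Suc n) l) \<longleftrightarrow>
          digraph_iso (with_proj G) (with_proj (extremal_graph (Suc n) l)))"
proof -
  let ?H = "extremal_graph (Suc n) l"
  have wf: "pair_wf_digraph G" by unfold_locales (use E in auto)
  have finV: "finite (pverts G)" using E by (simp add: finite_Domain finite_Range)
  note iso_eq = lambda_max_cong_iso[OF wf finV, of ?H]
  show ?thesis
  proof (cases "card (defects E) \<le> 2 * (n * l)")
    case True
    then obtain u v where uv: "u \<in> Domain E" "v \<in> Range E" "E = Domain E \<times> Range E - {(u, v)}"
      and c: "card (Domain E) = n + 1 \<and> card (Range E) = l + 1 \<or>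
        card (Domain E) = l + 1 \<and> card (Range E) = n + 1"
      using few_defects[OF E(1) n(1,2) e sides nc] by metis
    have arcs: "parcs G = (Domain E \<times> Range E - {(u, v)}) \<union> (Domain E \<times> Range E - {(u, v)})\<inverse>"
      using E(4) uv(3) by simp
    \<comment> \<open>Covers the case in which the larger side of \<open>G\<close> is its domain:
      the roles of the sides are exchanged.\<close>
    then have arcs': "parcs G = (Range E \<times> Domain E - {(v, u)}) \<union> (Range E \<times> Domain E - {(v, u)})\<inverse>"
      by auto
    have "digraph_iso (with_proj G) (with_proj ?H)"
      using c iso_extremal_graph[OF E(2,3) arcs uv(1,2), of n l]
        iso_extremal_graph[OF _ _ arcs' uv(2,1), of n l] E(2,3) by (auto simp: Int_commute Un_commute)
    then show ?thesis using iso_eq by simp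
  next
    case False
    have "pverts G \<noteq> {}" using sides(1) E(3) by auto
    moreover have "sym (parcs G)" unfolding E(4) by (rule sym_Un_converse)
    ultimately obtain f where "graph_eigenfunction G (lambda_max G) f"
      using lambda_max_eigenfunction[OF finV] by blast
    then have "lambda_max G ^ 4 \<le> real (card (rectangles E))"
      by (rule eigenvalue_pow4_le_rectangles[OF E])
    \<comment> \<open>By integrality, more than \<open>2 * (n * l)\<close> defects means at least
      one more, which is the slack of the lower bound for the extremal graph.\<close>
    also have "card (rectangles E) + (2 * (n * l) + 1) \<le> (card E)\<^sup>2"
      using card_rectangles_defects[OF E(1)] False by linarith
    then have "real (card (rectangles E) + (2 * (n * l) + 1)) \<le> real ((card E)\<^sup>2)"
      by (rule of_nat_mono)
    then have "real (card (rectangles E)) \<le> (real (card E))\<^sup>2 - 2 * real (n * l) - 1" by simp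
    also have "\<dots> < lambda_max ?H ^ 4"
      unfolding e by (rule lambda_max_extremal_graph_pow4(1)[OF n(1,3)])
    finally have "lambda_max G < lambda_max ?H"
      by (rule power_less_imp_less_base)
        (rule less_imp_le[OF lambda_max_extremal_graph_pow4(2)[OF n(1,3)]])
    then show ?thesis using iso_eq by auto
  qed
qed

theorem theorem8p1:
  fixes r l e p q :: nat
    and G :: "'a pair_pre_digraph"
  assumes "2 \<le> r" and "r \<le> l"
    and "e = r * l + r - 1"
    and "(r = 2 \<and> 2 \<le> p \<and> p \<le> q \<and> real l = (real e - 1) / 2 \<and> l < q) \<or>
         (3 \<le> r \<and> r \<le> l \<and> r \<le> p \<and> p \<le> l + 1 \<and> l + 1 \<le> q \<and>
          real q \<le> real l + 1 + real l / (real r - 1))"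
    and "G \<in> bipartite_family p q e"
  shows "lambda_max G \<le> lambda_max (extremal_graph r l) \<and>
         (lambda_max G = lambda_max (extremal_graph r l) \<longleftrightarrow>
          digraph_iso (with_proj G) (with_proj (extremal_graph r l)))"
proof -
  obtain n where r: "r = Suc n" using assms(1) by (cases r) auto
  have n: "1 \<le> n" "n \<le> l" "2 \<le> l" using assms(1,2) r by simp_all
  obtain E where E: "finite E" "Domain E \<inter> Range E = {}" "pverts G = Domain E \<union> Range E"
    "parcs G = E \<union> E\<inverse>" "card E = e" "card (Domain E) \<le> p" "card (Range E) \<le> q"
    "E \<noteq> Domain E \<times> Range E"
    using bipartite_family_edges[OF assms(5)] .
  have e: "card E = n * l + l + n" using assms(3) E(5) r by simp
  let ?a = "card (Domain E)" and ?b = "card (Range E)"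
  have "card E < card (Domain E \<times> Range E)"
    using E(1,8) by (intro psubset_card_mono) (auto simp: finite_Domain finite_Range)
  then have lt: "card E < ?a * ?b" by (simp add: card_cartesian_product)
  have le: "?a \<le> card E" "?b \<le> card E"
    using E(1) by (simp_all add: Domain_fst Range_snd card_image_le)
  \<comment> \<open>For \<open>n = 1\<close> a side with one vertex would give
    \<open>?a * ?b \<le> card E\<close>, against \<open>lt\<close>. For larger \<open>n\<close> only
    the second alternative on \<open>p\<close> and \<open>q\<close> remains. Its bound on
    \<open>q\<close> says \<open>n * q \<le> card E\<close>, and \<open>p \<le> l + 1\<close> gives
    \<open>card E < ?b * (l + 1)\<close>; each is compared with \<open>lt\<close>.\<close>
  have "n < ?a \<and> n < ?b"
  proof (cases "n = 1")
    case True
    have "?a \<noteq> 0" using lt by (metis mult_0 not_less_zero)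
    moreover have "?b \<noteq> 0" using lt by (metis mult_0_right not_less_zero)
    moreover have "?a \<noteq> 1" "?b \<noteq> 1" using lt le by auto
    ultimately show ?thesis using True by linarith
  next
    case False
    then have pq: "p \<le> l + 1" "real q \<le> real l + 1 + real l / real n"
      using assms(4) r by auto
    have "real (n * q) \<le> real (n * l + l + n)"
      using mult_left_mono[OF pq(2), of "real n"] n(1) by (simp add: algebra_simps)
    then have nq: "n * q \<le> card E" unfolding e by (simp only: of_nat_le_iff)
    have "n * q < ?a * q" using nq lt mult_le_mono2[OF E(7), of ?a] by linarith
    moreover have "n * (l + 1) < ?b * (l + 1)"
    proof -
      have "?a * ?b \<le> (l + 1) * ?b" using E(6) pq(1) by (intro mult_le_mono1) linarith
      then show ?thesis using lt e by (simp add: algebra_simps)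
    qed
    ultimately show ?thesis by (simp only: mult_less_cancel2)
  qed
  then show ?thesis
    unfolding r using lambda_max_le_extremal_graph[OF E(1-4) n e _ _ E(8)] by blast
qed

end
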